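(* Let $k\ge2$ be an integer and $M$ a matroid. The following are equivalent: (1) $M\in\mathcal E_k$; (2) every $k$-dimensional induced restriction of $M$ has even size; (3) there are matroids $M_0,M_1,\dots,M_s$ and $N_0,\dots,N_{s-1}\in\mathcal E_{k-1}$ such that $\dim(M_0)\le k-1$ and $M_s=M$, while for each $i\in\{0,\dots,s-1\}$, $M_i$ and $N_i$ have the same projective geometry $G(M_i)=G(N_i)$ and $M_{i+1}$ is isomorphic to the twist doubling of $M_i$ with respect to $N_i$.
   Context: A simple binary matroid (here just "matroid") is a pair $M=(E,G)$, where $G$ is identified with $\mathbb F_2^n\setminus\{0\}$ for some $n\ge0$ and $E\subseteq G$; $\dim(M)=n$, $G(M)=G$. A flat of $G$ is a set $V\setminus\{0\}$ with $V$ a subspace, of dimension $\dim V$; a hyperplane is a flat of dimension $n-1$. A $d$-dimensional induced restriction of $M$ is $M|F=(E\cap F,F)$ for a flat $F$ of dimension $d$; its size is $|E\cap F|$. Isomorphism of $(E,G)$ and $(E',G')$ means a bijective linear map $G'\to G$ (on underlying vector spaces) carrying $E'$ onto $E$. For an integer $k$, $\mathcal E_k$ is the class of matroids $(E,G)$ with $|E\cap F|$ even for every flat $F$ of dimension at least $k$. Twist doubling: given $M=(E,G)$ and $N=(D,G)$, let $G'$ be a projective geometry having $G$ as a hyperplane and $w\in G'\setminus G$; the twist doubling of $M$ with respect to $N$ is $(E\cup\{w+x:x\in E\triangle D\},G')$, well defined up to isomorphism. *)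

theory Defs
  imports Complex_Main "HOL-Library.Z2" "HOL-Library.Function_Algebras"
begin

text \<open>
  All vector spaces live inside one ambient space over the two-element field \<^typ>\<open>bit\<close>,
  the space \<^typ>\<open>nat \<Rightarrow> bit\<close> with pointwise operations. It contains subspaces of every finite
  dimension, and any finite subspace is properly contained in a larger finite one, so
  it contains a copy of every matroid and is never too small for a twist doubling
  (see the lemmas \<open>ex_projective_geometry\<close> and \<open>ex_twist_doubling\<close>).
\<close>

type_synonym f2vec = "nat \<Rightarrow> bit"

definition f2_scale :: "bit \<Rightarrow> f2vec \<Rightarrow> f2vec" where
  "f2_scale c v = (\<lambda>i. c * v i)"

interpretation F2: vector_space f2_scale
  by unfold_locales (auto simp: f2_scale_def fun_eq_iff algebra_simps)

text \<open>A finite-dimensional space over a finite field is the same as a finite one.\<close>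

definition projective_geometry :: "f2vec set \<Rightarrow> bool" where
  "projective_geometry G \<longleftrightarrow> (\<exists>V. F2.subspace V \<and> finite V \<and> G = V - {0})"

definition geom_dim :: "f2vec set \<Rightarrow> nat" where
  "geom_dim G = F2.dim (insert 0 G)"

definition flat :: "f2vec set \<Rightarrow> f2vec set \<Rightarrow> bool" where
  "flat G F \<longleftrightarrow> F \<subseteq> G \<and> (\<exists>W. F2.subspace W \<and> F = W - {0})"

definition hyperplane :: "f2vec set \<Rightarrow> f2vec set \<Rightarrow> bool" where
  "hyperplane G H \<longleftrightarrow> flat G H \<and> geom_dim H + 1 = geom_dim G"

text \<open>A matroid \<open>(E, G)\<close> is encoded as a pair: \<open>fst M\<close> is \<open>E\<close> and \<open>snd M\<close> is \<open>G\<close>.\<close>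

type_synonym matroid = "f2vec set \<times> f2vec set"

definition matroid :: "matroid \<Rightarrow> bool" where
  "matroid M \<longleftrightarrow> projective_geometry (snd M) \<and> fst M \<subseteq> snd M"

definition mdim :: "matroid \<Rightarrow> nat" where
  "mdim M = geom_dim (snd M)"

definition restriction :: "matroid \<Rightarrow> f2vec set \<Rightarrow> matroid" where
  "restriction M F = (fst M \<inter> F, F)"

definition induced_restriction :: "matroid \<Rightarrow> matroid \<Rightarrow> bool" where
  "induced_restriction M R \<longleftrightarrow> (\<exists>F. flat (snd M) F \<and> R = restriction M F)"

definition msize :: "matroid \<Rightarrow> nat" where
  "msize M = card (fst M)"

text \<open>
  Linear maps are only required to be linear on the space \<open>insert 0 (snd M')\<close>; their values
  elsewhere are irrelevant.
\<close>

definition isomorphic :: "matroid \<Rightarrow> matroid \<Rightarrow> bool" where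
  "isomorphic M M' \<longleftrightarrow>
     (\<exists>f. bij_betw f (insert 0 (snd M')) (insert 0 (snd M)) \<and>
          (\<forall>x\<in>insert 0 (snd M'). \<forall>y\<in>insert 0 (snd M'). f (x + y) = f x + f y) \<and>
          (\<forall>c. \<forall>x\<in>insert 0 (snd M'). f (f2_scale c x) = f2_scale c (f x)) \<and>
          f ` fst M' = fst M)"

definition even_class :: "nat \<Rightarrow> matroid set" where
  "even_class k =
     {M. matroid M \<and> (\<forall>F. flat (snd M) F \<and> k \<le> geom_dim F \<longrightarrow> even (card (fst M \<inter> F)))}"

text \<open>
  Twist doubling is a relation, since the result depends on the choice of the larger
  geometry \<open>G'\<close> and of \<open>w\<close>; it is only determined up to isomorphism.
\<close>

definition twist_doubling :: "matroid \<Rightarrow> matroid \<Rightarrow> matroid \<Rightarrow> bool" where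
  "twist_doubling M N T \<longleftrightarrow> snd M = snd N \<and>
     (\<exists>G' w. projective_geometry G' \<and> hyperplane G' (snd M) \<and> w \<in> G' - snd M \<and>
        T = (fst M \<union> {w + x |x. x \<in> sym_diff (fst M) (fst N)}, G'))"

lemma f2_scale_cases: "f2_scale c x = 0 \<or> f2_scale c x = x"
  by (cases c) (auto simp: f2_scale_def fun_eq_iff)

lemma extend_geometry:
  assumes G: "projective_geometry G"
  shows "\<exists>G' w. projective_geometry G' \<and> hyperplane G' G \<and> w \<in> G' - G"
proof -
  obtain V where V: "F2.subspace V" "finite V" "G = V - {0}"
    using G by (auto simp: projective_geometry_def)
  have "infinite (UNIV :: f2vec set)"
  proof
    assume fin: "finite (UNIV :: f2vec set)"
    have "inj (\<lambda>(n::nat) i. if i = n then 1 else (0::bit))"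
      by (auto simp: inj_def fun_eq_iff split: if_splits)
    then show False
      using fin finite_subset[OF subset_UNIV] finite_imageD infinite_UNIV_nat by blast
  qed
  then obtain w where w: "w \<notin> V"
    using V(2) by (metis UNIV_eq_I)
  define V' where "V' = F2.span (insert w V)"
  have V0: "0 \<in> V" using V(1) by (rule F2.subspace_0)
  have spanV: "F2.span V = V"
    using V(1) by simp
  have "V' \<subseteq> V \<union> (+) w ` V"
  proof
    fix x assume "x \<in> V'"
    then obtain c where c: "x - f2_scale c w \<in> V"
      unfolding V'_def F2.span_insert spanV by blast
    show "x \<in> V \<union> (+) w ` V"
    proof (cases "f2_scale c w = 0")
      case False
      then have "x = w + (x - f2_scale c w)" using f2_scale_cases[of c w] by auto
      then show ?thesis using c by blast
    qed (use c in auto)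
  qed
  then have finV': "finite V'"
    using V(2) finite_subset by blast
  obtain B where B: "B \<subseteq> V" "F2.independent B" "V \<subseteq> F2.span B" "card B = F2.dim V"
    using F2.basis_exists by blast
  have spB: "F2.span B = V"
    using B V(1) F2.span_minimal by blast
  have finB: "finite B" using B(1) V(2) finite_subset by blast
  have indB: "F2.independent (insert w B)"
    using B(2) w spB F2.independent_insert by auto
  have "F2.span (insert w B) = V'"
    unfolding V'_def F2.span_insert spB spanV ..
  then have "F2.dim V' = card (insert w B)"
    using indB F2.dim_span_eq_card_independent by metis
  also have "\<dots> = F2.dim V + 1"
    using finB B w by (subst card_insert_disjoint) auto
  finally have dimV': "F2.dim V' = F2.dim V + 1" .
  have sub: "insert w V \<subseteq> V'" unfolding V'_def by (rule F2.span_superset)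
  have sV': "F2.subspace V'" unfolding V'_def by simp
  have "projective_geometry (V' - {0})"
    using sV' finV' unfolding projective_geometry_def by blast
  moreover have "hyperplane (V' - {0}) G"
    using V sub V0 dimV' unfolding hyperplane_def flat_def geom_dim_def
    by (auto simp: insert_absorb F2.subspace_0[OF sV'])
  moreover have "w \<in> (V' - {0}) - G"
    using w V V0 sub by auto
  ultimately show ?thesis by blast
qed

lemma ex_projective_geometry: "\<exists>G. projective_geometry G \<and> geom_dim G = n"
proof (induction n)
  case 0
  have "projective_geometry {}"
    unfolding projective_geometry_def by (intro exI[of _ "{0}"]) auto
  moreover have "geom_dim {} = 0"
    unfolding geom_dim_def
    using F2.dim_span_eq_card_independent[of "{}"] F2.independent_empty by simp
  ultimately show ?case by blast
next
  case (Suc n)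
  then show ?case using extend_geometry unfolding hyperplane_def by (metis Suc_eq_plus1)
qed

lemma ex_twist_doubling:
  assumes "matroid M" "snd M = snd N"
  shows "\<exists>T. twist_doubling M N T"
  using extend_geometry[of "snd M"] assms
  unfolding twist_doubling_def matroid_def by blast

end

theory Submission
  imports Defs
begin

text \<open>
  Everything is a parity count on cosets of subspaces. If \<open>L\<close> has codimension two in \<open>F\<close>, then
  \<open>|E \<inter> F| + 2 |E \<inter> L|\<close> is the sum of \<open>|E \<inter> H|\<close> over the three hyperplanes \<open>H\<close> of \<open>F\<close> through \<open>L\<close>,
  so evenness propagates from dimension \<open>k\<close> upwards. For a twist doubling of \<open>(E, G)\<close> with respect
  to \<open>(D, G)\<close>, a flat not inside \<open>G\<close> meets \<open>G\<close> in a flat \<open>L\<close> and consists otherwise of a coset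
  \<open>w + x + L\<close>; modulo two its size is \<open>|E \<inter> L| + |E \<inter> (x + L)| + |D \<inter> (x + L)|\<close>, which is even if
  \<open>E\<close> is in the class of \<open>k\<close> and \<open>D\<close> in that of \<open>k - 1\<close>. Conversely, a matroid of dimension at
  least \<open>k\<close> in the class of \<open>k\<close> misses some point \<open>w\<close>, since a full geometry has odd size, and it
  is a twist doubling of its restriction to any hyperplane avoiding \<open>w\<close>.
\<close>

subsection \<open>Finite subspaces over the two-element field\<close>

lemma f2vec_add_self [simp]: "(x::f2vec) + x = 0"
  by (simp add: fun_eq_iff)

lemma f2vec_add_self_left [simp]: "(x::f2vec) + (x + y) = y"
  by (simp add: add.assoc[symmetric])

text \<open>Multiplying by a scalar gives either zero or the vector itself, so closure under scalars
  comes for free.\<close>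

lemma f2_subspaceI:
  assumes "0 \<in> W" "\<And>x y. x \<in> W \<Longrightarrow> y \<in> W \<Longrightarrow> x + y \<in> W"
  shows "F2.subspace W"
  unfolding F2.subspace_def using assms f2_scale_cases by metis

abbreviation translate :: "f2vec \<Rightarrow> f2vec set \<Rightarrow> f2vec set" where
  "translate w W \<equiv> (+) w ` W"

text \<open>For a subspace \<open>W\<close> this is the span of \<open>w\<close> and
  \<open>W\<close>, because the only scalars are 0 and 1. The union form exposes the two cosets for
  counting.\<close>

abbreviation adjoin :: "f2vec \<Rightarrow> f2vec set \<Rightarrow> f2vec set" where
  "adjoin w W \<equiv> W \<union> translate w W"

text \<open>Adding \<open>w\<close> is an involution, so membership in a coset becomes a condition
  without an existential quantifier.\<close>

lemma mem_translate_iff: "y \<in> translate w W \<longleftrightarrow> w + y \<in> W"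
  by (auto simp: image_iff intro: bexI[of _ "w + y"])

lemma setcompr_eq_translate: "{w + x |x. x \<in> A} = translate w A"
  by blast

lemma subspace_adjoin:
  assumes "F2.subspace W"
  shows "F2.subspace (adjoin w W)"
proof (rule f2_subspaceI)
  show "0 \<in> adjoin w W" using assms F2.subspace_0 by auto
  fix x y assume xy: "x \<in> adjoin w W" "y \<in> adjoin w W"
  have a: "a + b \<in> W" if "a \<in> W" "b \<in> W" for a b
    using F2.subspace_add[OF assms that] .
  \<comment> \<open>One identity for each case in which at least one summand lies in the coset of
    \<open>w\<close>.\<close>
  have e: "w + (x + y) = (w + x) + y" "w + (x + y) = x + (w + y)" "x + y = (w + x) + (w + y)"
    using f2vec_add_self_left[of w "x + y"] by (simp_all add: ac_simps)
  show "x + y \<in> adjoin w W"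
    using xy a[of x y] a[of "w + x" y] a[of x "w + y"] a[of "w + x" "w + y"] e
    unfolding Un_iff mem_translate_iff by metis
qed

lemma span_insert_eq_adjoin:
  assumes "F2.subspace W"
  shows "F2.span (insert w W) = adjoin w W"
proof (rule F2.span_unique)
  show "insert w W \<subseteq> adjoin w W"
    using F2.subspace_0[OF assms] by (auto simp: mem_translate_iff)
  show "adjoin w W \<subseteq> T'" if "insert w W \<subseteq> T'" "F2.subspace T'" for T'
    using that by (auto intro: F2.subspace_add)
qed (rule subspace_adjoin[OF assms])

lemma subspace_translate_disjoint:
  assumes "F2.subspace W" "w \<notin> W"
  shows "W \<inter> translate w W = {}"
proof -
  have False if "y \<in> W" "w + y \<in> W" for y
    using F2.subspace_add[OF assms(1) that(2,1)] assms(2) by (simp add: add.assoc)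
  then show ?thesis by (auto simp: mem_translate_iff)
qed

lemma subspace_translate_absorb:
  assumes "F2.subspace W" "w \<in> W"
  shows "translate w W = W"
proof -
  have "w + y \<in> W \<longleftrightarrow> y \<in> W" for y
    using F2.subspace_add[OF assms] F2.subspace_add[OF assms, of "w + y"] by auto
  then show ?thesis by (auto simp: mem_translate_iff)
qed

lemma card_translate: "card (translate w W) = card W"
  by (rule card_image) (simp add: inj_on_def)

section \<open>Cardinality, dimension and complements\<close>

lemma card_adjoin:
  assumes "F2.subspace W" "finite W" "w \<notin> W"
  shows "card (adjoin w W) = 2 * card W"
  using assms subspace_translate_disjoint
  by (subst card_Un_disjoint) (auto simp: card_translate)

text \<open>Each new independent vector doubles the span.\<close>

lemma card_span_independent:
  assumes "finite B" "F2.independent B"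
  shows "finite (F2.span B) \<and> card (F2.span B) = 2 ^ card B"
  using assms
proof (induction B rule: finite_induct)
  case (insert b B)
  have ind: "F2.independent B" "b \<notin> F2.span B"
    using insert.prems insert.hyps F2.independent_insert by auto
  have "F2.span (insert b B) = adjoin b (F2.span B)"
    using span_insert_eq_adjoin[of "F2.span B" b] F2.span_span F2.subspace_span
    by (metis F2.span_insert)
  then show ?case
    using insert.IH[OF ind(1)] insert.hyps ind(2) card_adjoin[of "F2.span B" b] by simp
qed simp

text \<open>This is the bridge by which dimensions are compared through cardinalities from here
  on.\<close>

lemma card_eq_2_pow_dim:
  assumes "F2.subspace W" "finite W"
  shows "card W = 2 ^ F2.dim W"
proof -
  obtain B where B: "B \<subseteq> W" "F2.independent B" "W \<subseteq> F2.span B" "card B = F2.dim W"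
    using F2.basis_exists by blast
  then have "F2.span B = W" using assms(1) F2.span_minimal by blast
  then show ?thesis using card_span_independent[of B] B assms(2) finite_subset by metis
qed

lemma dim_le_if_subspace_subset:
  assumes "F2.subspace U" "F2.subspace W" "finite W" "U \<subseteq> W"
  shows "F2.dim U \<le> F2.dim W"
proof -
  have "finite U" using assms finite_subset by blast
  then have "(2::nat) ^ F2.dim U \<le> 2 ^ F2.dim W"
    using card_mono[OF assms(3,4)] assms card_eq_2_pow_dim by simp
  then show ?thesis by simp
qed

lemma dim_adjoin:
  assumes "F2.subspace W" "finite W" "w \<notin> W"
  shows "F2.dim (adjoin w W) = F2.dim W + 1"
proof -
  have "(2::nat) ^ F2.dim (adjoin w W) = 2 ^ (F2.dim W + 1)"
    using card_adjoin[OF assms] card_eq_2_pow_dim[OF subspace_adjoin[OF assms(1)]]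
      card_eq_2_pow_dim[OF assms(1,2)] assms(2) by simp
  then show ?thesis by (simp only: power_inject_exp)
qed

text \<open>Extend \<open>w\<close> to a basis of \<open>V\<close> and let \<open>H\<close> be the
  span of the other basis vectors.\<close>

lemma ex_complement_hyperplane:
  assumes "F2.subspace V" "w \<in> V" "w \<noteq> 0"
  obtains H where "F2.subspace H" "w \<notin> H" "V = adjoin w H"
proof -
  have "F2.independent {w}" using assms(3) by simp
  then obtain B where B: "{w} \<subseteq> B" "B \<subseteq> V" "F2.independent B" "V \<subseteq> F2.span B"
    using F2.maximal_independent_subset_extend[of "{w}" V] assms(2) by blast
  define H where "H = F2.span (B - {w})"
  have sH: "F2.subspace H" unfolding H_def by simp
  have "w \<notin> H" using B(1,3) unfolding H_def F2.dependent_def by blast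
  moreover have "V = adjoin w H"
  proof -
    have "V = F2.span B" using B assms(1) F2.span_minimal by blast
    also have "\<dots> = F2.span (insert w (B - {w}))" using B(1) by (simp add: insert_absorb)
    also have "\<dots> = F2.span (insert w H)"
      unfolding H_def by (simp only: F2.span_insert F2.span_span)
    finally show ?thesis using span_insert_eq_adjoin[OF sH] by simp
  qed
  ultimately show ?thesis using that sH by blast
qed

text \<open>Elements of \<open>F\<close> outside \<open>H\<close> all lie in the single coset of
  \<open>w\<close>, so the sum of any two of them lies in \<open>H\<close>. Hence
  \<open>F \<inter> H\<close> has index two in \<open>F\<close>.\<close>

lemma subspace_eq_adjoin_Int:
  assumes "F2.subspace F" "F2.subspace H" "F \<subseteq> adjoin w H" "f \<in> F" "f \<notin> H"
  shows "F = adjoin f (F \<inter> H)"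
proof
  have fw: "w + f \<in> H" using assms(3-5) by (auto simp: mem_translate_iff)
  show "F \<subseteq> adjoin f (F \<inter> H)"
  proof
    fix y assume y: "y \<in> F"
    show "y \<in> adjoin f (F \<inter> H)"
    proof (cases "y \<in> H")
      case False
      then have "w + y \<in> H" using y assms(3) by (auto simp: mem_translate_iff)
      then have "(w + f) + (w + y) \<in> H" by (rule F2.subspace_add[OF assms(2) fw])
      moreover have "(w + f) + (w + y) = f + y"
        using f2vec_add_self_left[of w "f + y"] by (simp add: ac_simps)
      ultimately show ?thesis
        using F2.subspace_add[OF assms(1,4) y] by (simp add: mem_translate_iff)
    qed (use y in simp)
  qed
  show "adjoin f (F \<inter> H) \<subseteq> F"
    using assms(1,4) by (auto intro: F2.subspace_add)
qed

subsection \<open>Parity counts\<close>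

lemma even_card_sym_diff:
  assumes "finite A" "finite B"
  shows "even (card (sym_diff A B)) \<longleftrightarrow> (even (card A) \<longleftrightarrow> even (card B))"
proof -
  have "card A = card (A - B) + card (A \<inter> B)" "card B = card (B - A) + card (A \<inter> B)"
    using assms card_Diff_subset_Int[of A B] card_Diff_subset_Int[of B A]
      card_mono[of A "A \<inter> B"] card_mono[of B "A \<inter> B"] by (auto simp: Int_commute)
  moreover have "card (sym_diff A B) = card (A - B) + card (B - A)"
    using assms by (subst card_Un_disjoint) auto
  ultimately show ?thesis by auto
qed

lemma card_Int_adjoin:
  assumes "F2.subspace L" "finite L" "x \<notin> L"
  shows "card (E \<inter> adjoin x L) = card (E \<inter> L) + card (E \<inter> translate x L)"
proof -
  have "E \<inter> adjoin x L = (E \<inter> L) \<union> (E \<inter> translate x L)" by blast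
  then show ?thesis
    using assms subspace_translate_disjoint[OF assms(1,3)]
    by (subst card_Un_disjoint[symmetric]) auto
qed

text \<open>The parity condition of \<open>even_class\<close>, phrased with subspaces instead of
  flats so that zero need not be removed and reinserted in the counts.\<close>

definition even_on :: "nat \<Rightarrow> f2vec set \<Rightarrow> f2vec set \<Rightarrow> bool" where
  "even_on k E V \<longleftrightarrow>
     (\<forall>W. F2.subspace W \<and> W \<subseteq> V \<and> k \<le> F2.dim W \<longrightarrow> even (card (E \<inter> W)))"

lemma even_onD:
  "even_on k E V \<Longrightarrow> F2.subspace W \<Longrightarrow> W \<subseteq> V \<Longrightarrow> k \<le> F2.dim W \<Longrightarrow> even (card (E \<inter> W))"
  unfolding even_on_def by blast

lemma ex_nonzero_if_dim_pos:
  assumes "F2.subspace W" "finite W" "0 < F2.dim W"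
  obtains w where "w \<in> W" "w \<noteq> 0"
proof -
  have "card W \<noteq> 1" using assms(3) card_eq_2_pow_dim[OF assms(1,2)] by simp
  then have "W \<noteq> {0}" by auto
  then show ?thesis using that F2.subspace_0[OF assms(1)] by blast
qed

text \<open>Induction on the excess of the dimension over \<open>k\<close>, using the three
  hyperplanes of \<open>F\<close> through a subspace \<open>L\<close> of codimension two. Since
  \<open>1 \<le> k\<close>, a hyperplane \<open>H\<close> of \<open>F\<close> has a nonzero vector
  \<open>u\<close>, so such an \<open>L\<close> exists already in the first step.\<close>

lemma even_on_if_even_dim_eq:
  assumes "1 \<le> k" "finite V"
    and even: "\<And>W. F2.subspace W \<Longrightarrow> W \<subseteq> V \<Longrightarrow> F2.dim W = k \<Longrightarrow> even (card (E \<inter> W))"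
  shows "even_on k E V"
proof -
  have "F2.subspace F \<Longrightarrow> F \<subseteq> V \<Longrightarrow> F2.dim F = k + n \<Longrightarrow> even (card (E \<inter> F))" for F n
  proof (induction n arbitrary: F)
    case 0
    then show ?case using even by simp
  next
    case (Suc n)
    have finF: "finite F" using Suc.prems(2) assms(2) finite_subset by blast
    obtain w where w: "w \<in> F" "w \<noteq> 0"
      using ex_nonzero_if_dim_pos[OF Suc.prems(1) finF] Suc.prems(3) by auto
    obtain H where H: "F2.subspace H" "w \<notin> H" "F = adjoin w H"
      using ex_complement_hyperplane[OF Suc.prems(1) w] .
    have finH: "finite H" using H(3) finF by simp
    have dH: "F2.dim H = k + n" using dim_adjoin[OF H(1) finH H(2)] H(3) Suc.prems(3) by simp
    then obtain u where u: "u \<in> H" "u \<noteq> 0"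
      using ex_nonzero_if_dim_pos[OF H(1) finH] assms(1) by auto
    obtain L where L: "F2.subspace L" "u \<notin> L" "H = adjoin u L"
      using ex_complement_hyperplane[OF H(1) u] .
    have finL: "finite L" using L(3) finH by simp
    have dL: "F2.dim L + 1 = k + n" using dim_adjoin[OF L(1) finL L(2)] L(3) dH by simp
    have wL: "w \<notin> L" using H(2) L(3) by blast
    have wu: "w + u \<notin> H"
      using H(2) F2.subspace_add[OF H(1) _ u(1), of "w + u"] by (auto simp: add.assoc)
    have wuL: "w + u \<notin> L" using wu L(3) by blast
    have F: "w \<in> F" "w + u \<in> F" using w(1) u(1) H(3) by blast+
    have sub: "adjoin x L \<subseteq> F" if "x \<in> F" for x
      using that F2.subspace_add[OF Suc.prems(1)] H(3) L(3) by blast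
    have three: "even (card (E \<inter> H))" "even (card (E \<inter> adjoin w L))"
        "even (card (E \<inter> adjoin (w + u) L))"
      using Suc.IH[OF H(1)] Suc.IH[OF subspace_adjoin[OF L(1)]] sub[OF F(1)] sub[OF F(2)]
        Suc.prems(2) H(3) dH dL dim_adjoin[OF L(1) finL] wL wuL by (auto simp: subset_trans)
    \<comment> \<open>The cosets of \<open>w\<close> and \<open>w + u\<close> modulo
      \<open>L\<close> are the parts outside \<open>H\<close> of the two other hyperplanes through
      \<open>L\<close>.\<close>
    have "translate w H = translate w L \<union> translate (w + u) L"
      unfolding L(3) by (auto simp: image_Un image_image add.assoc)
    moreover have "translate w L \<inter> translate (w + u) L = {}"
    proof -
      have "False" if "w + y \<in> L" "w + u + y \<in> L" for y
      proof -
        have "u = (w + y) + (w + u + y)"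
          using f2vec_add_self_left[of w "y + (y + u)"] by (simp add: ac_simps)
        then show False using F2.subspace_add[OF L(1) that] L(2) by metis
      qed
      then show ?thesis unfolding disjoint_iff mem_translate_iff by blast
    qed
    ultimately have "card (E \<inter> translate w H)
        = card (E \<inter> translate w L) + card (E \<inter> translate (w + u) L)"
      using finL by (subst card_Un_disjoint[symmetric]) (auto simp: Int_Un_distrib)
    \<comment> \<open>Adding the counts on \<open>adjoin w L\<close> and
      \<open>adjoin (w + u) L\<close> counts \<open>E \<inter> L\<close> twice and
      \<open>E \<inter> translate w H\<close> once, so the latter is even;
      \<open>E \<inter> H\<close> is even by induction.\<close>
    then show ?case
      using three card_Int_adjoin[OF H(1) finH H(2), of E] card_Int_adjoin[OF L(1) finL wL, of E]
        card_Int_adjoin[OF L(1) finL wuL, of E]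
      unfolding H(3) by (metis even_add)
  qed
  then show ?thesis unfolding even_on_def by (metis le_iff_add)
qed

section \<open>Parity under twisting and untwisting\<close>

text \<open>A subspace inside \<open>H\<close> sees only \<open>E\<close>. Any other
  \<open>F\<close> loses one dimension on intersecting with \<open>H\<close>, which is why
  \<open>D\<close> is required to be even one dimension lower than \<open>E\<close>.\<close>

lemma even_on_twist:
  assumes H: "F2.subspace H" "finite H" "w \<notin> H"
    and E: "E \<subseteq> H" "even_on (Suc k) E H" and D: "D \<subseteq> H" "even_on k D H"
  shows "even_on (Suc k) (E \<union> translate w (sym_diff E D)) (adjoin w H)"
  unfolding even_on_def
proof safe
  fix F assume F: "F2.subspace F" "F \<subseteq> adjoin w H" "Suc k \<le> F2.dim F"
  let ?S = "sym_diff E D" and ?T = "E \<union> translate w (sym_diff E D)"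
  have SH: "?S \<subseteq> H" using E D by blast
  have dis: "H \<inter> translate w H = {}" by (rule subspace_translate_disjoint[OF H(1,3)])
  show "even (card (?T \<inter> F))"
  proof (cases "F \<subseteq> H")
    case True
    then have "?T \<inter> F = E \<inter> F" using dis SH by blast
    then show ?thesis using even_onD[OF E(2) F(1) True F(3)] by simp
  next
    case False
    then obtain f where f: "f \<in> F" "f \<notin> H" by blast
    define L where "L = F \<inter> H"
    \<comment> \<open>The part of \<open>F\<close> outside \<open>H\<close> is the coset of
      \<open>f\<close>, which is the coset \<open>translate x L\<close> inside \<open>H\<close>
      shifted by \<open>w\<close>.\<close>
    define x where "x = w + f"
    have FL: "F = adjoin f L"
      unfolding L_def using subspace_eq_adjoin_Int[OF F(1) H(1) F(2) f] .
    have xH: "x \<in> H" using f F(2) unfolding x_def by (auto simp: mem_translate_iff)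
    have sL: "F2.subspace L" unfolding L_def using F(1) H(1) by (rule F2.subspace_inter)
    have LH: "L \<subseteq> H" and finL: "finite L" and fL: "f \<notin> L"
      using H(2) f(2) unfolding L_def by auto
    have dL: "k \<le> F2.dim L" using dim_adjoin[OF sL finL fL] F(3) FL by simp
    have xLH: "translate x L \<subseteq> H" using F2.subspace_add[OF H(1) xH] LH by blast
    have "?T \<inter> L = E \<inter> L" using dis SH LH by blast
    moreover have "?T \<inter> translate f L = translate w (?S \<inter> translate x L)"
    proof -
      have "translate f L = translate w (translate x L)"
        unfolding x_def by (simp add: image_image add.assoc)
      moreover have "translate w (translate x L) \<subseteq> translate w H"
        using xLH by (rule image_mono)
      ultimately have "?T \<inter> translate f L = translate w ?S \<inter> translate w (translate x L)"
        using dis E(1) by blast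
      then show ?thesis unfolding set_eq_iff Int_iff mem_translate_iff by simp
    qed
    ultimately have "card (?T \<inter> F) = card (E \<inter> L) + card (?S \<inter> translate x L)"
      using card_Int_adjoin[OF sL finL fL, of ?T] card_translate FL by simp
    moreover have "?S \<inter> translate x L = sym_diff (E \<inter> translate x L) (D \<inter> translate x L)"
      by blast
    ultimately have parity: "even (card (?T \<inter> F)) \<longleftrightarrow>
        (even (card (E \<inter> L)) \<longleftrightarrow>
          (even (card (E \<inter> translate x L)) \<longleftrightarrow> even (card (D \<inter> translate x L))))"
      using even_card_sym_diff[of "E \<inter> translate x L" "D \<inter> translate x L"] finL by simp
    have DL: "even (card (D \<inter> L))" using even_onD[OF D(2) sL LH dL] .
    show ?thesis
    proof (cases "x \<in> L")
      \<comment> \<open>Here \<open>translate x L\<close> is \<open>L\<close>, so the two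
        contributions of \<open>E\<close> cancel modulo two, whatever the parity of
        \<open>E \<inter> L\<close>.\<close>
      case True
      then show ?thesis
        using parity DL subspace_translate_absorb[OF sL True] by simp
    next
      case False
      \<comment> \<open>\<open>L\<close> alone may be too small for \<open>E\<close>, but its two
        cosets together form a subspace large enough. For \<open>D\<close> both \<open>L\<close> and
        \<open>adjoin x L\<close> are large enough, hence so is the count on their difference
        even.\<close>
      have dx: "Suc k \<le> F2.dim (adjoin x L)" using dim_adjoin[OF sL finL False] dL by simp
      have sub: "adjoin x L \<subseteq> H" using LH xLH by blast
      have "even (card (E \<inter> adjoin x L))" "even (card (D \<inter> adjoin x L))"
        using even_onD[OF E(2) subspace_adjoin[OF sL] sub dx]
          even_onD[OF D(2) subspace_adjoin[OF sL] sub] dx by auto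
      then show ?thesis
        using parity DL card_Int_adjoin[OF sL finL False] by simp
    qed
  qed
qed

text \<open>For \<open>F\<close> inside \<open>H\<close>, the symmetric difference meets
  \<open>F\<close> in a set whose size has the parity of the size of
  \<open>E \<inter> adjoin w F\<close>, and \<open>adjoin w F\<close> has one dimension more than
  \<open>F\<close>.\<close>

lemma even_on_untwist:
  assumes H: "F2.subspace H" "finite H" "w \<notin> H"
    and E: "w \<notin> E" "even_on (Suc k) E (adjoin w H)"
  shows "even_on k (sym_diff (E \<inter> H) (translate w E \<inter> H)) H"
  unfolding even_on_def
proof safe
  fix F assume F: "F2.subspace F" "F \<subseteq> H" "k \<le> F2.dim F"
  have wF: "w \<notin> F" and finF: "finite F" using F(2) H finite_subset by auto
  have "Suc k \<le> F2.dim (adjoin w F)" using dim_adjoin[OF F(1) finF wF] F(3) by simp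
  then have "even (card (E \<inter> adjoin w F))"
    using even_onD[OF E(2) subspace_adjoin[OF F(1)]] F(2) by blast
  moreover have "E \<inter> translate w F = translate w (translate w E \<inter> F)"
    unfolding set_eq_iff Int_iff mem_translate_iff by simp
  moreover have "sym_diff (E \<inter> H) (translate w E \<inter> H) \<inter> F
      = sym_diff (E \<inter> F) (translate w E \<inter> F)"
    using F(2) by blast
  ultimately show "even (card (sym_diff (E \<inter> H) (translate w E \<inter> H) \<inter> F))"
    using card_Int_adjoin[OF F(1) finF wF, of E] finF card_translate
      even_card_sym_diff[of "E \<inter> F" "translate w E \<inter> F"] by simp
qed

subsection \<open>Matroids\<close>

text \<open>The underlying space is recovered as \<open>insert 0 (snd M)\<close>, which removes the
  existential quantifier over subspaces.\<close>

lemma matroid_iff: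
  "matroid M \<longleftrightarrow> F2.subspace (insert 0 (snd M)) \<and> finite (snd M) \<and> 0 \<notin> snd M \<and> fst M \<subseteq> snd M"
proof
  assume "matroid M"
  then obtain V where "F2.subspace V" "finite V" "snd M = V - {0}" "fst M \<subseteq> snd M"
    unfolding matroid_def projective_geometry_def by blast
  moreover from this have "insert 0 (snd M) = V" using F2.subspace_0 by auto
  ultimately show "F2.subspace (insert 0 (snd M)) \<and> finite (snd M) \<and> 0 \<notin> snd M \<and> fst M \<subseteq> snd M"
    by simp
next
  assume *: "F2.subspace (insert 0 (snd M)) \<and> finite (snd M) \<and> 0 \<notin> snd M \<and> fst M \<subseteq> snd M"
  then show "matroid M"
    unfolding matroid_def projective_geometry_def
    by (intro conjI exI[of _ "insert 0 (snd M)"]) auto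
qed

lemma flat_iff:
  assumes "0 \<notin> G"
  shows "flat G F \<longleftrightarrow> (\<exists>W. F2.subspace W \<and> W \<subseteq> insert 0 G \<and> F = W - {0})"
  using assms unfolding flat_def by blast

lemma geom_dim_Diff_zero: "F2.subspace W \<Longrightarrow> geom_dim (W - {0}) = F2.dim W"
  unfolding geom_dim_def using F2.subspace_0 by (simp add: insert_absorb)

text \<open>The ground set avoids zero, so a flat and its subspace meet it in the same set.\<close>

lemma even_class_iff:
  "M \<in> even_class k \<longleftrightarrow> matroid M \<and> even_on k (fst M) (insert 0 (snd M))"
proof (cases "matroid M")
  case True
  then have M: "0 \<notin> snd M" "fst M \<subseteq> snd M" unfolding matroid_iff by auto
  have "fst M \<inter> (W - {0}) = fst M \<inter> W" for W using M by blast
  then show ?thesis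
    using True unfolding even_class_def even_on_def mem_Collect_eq flat_iff[OF M(1)]
    by (metis geom_dim_Diff_zero)
qed (simp add: even_class_def)

text \<open>One direction is a special case of the definition; the other is the propagation of
  evenness to higher dimensions.\<close>

lemma even_class_iff_induced_restriction:
  assumes "1 \<le> k" "matroid M"
  shows "M \<in> even_class k \<longleftrightarrow>
    (\<forall>R. induced_restriction M R \<and> mdim R = k \<longrightarrow> even (msize R))"
proof
  assume M: "M \<in> even_class k"
  show "\<forall>R. induced_restriction M R \<and> mdim R = k \<longrightarrow> even (msize R)"
    using M unfolding even_class_def induced_restriction_def restriction_def mdim_def msize_def
    by auto
next
  assume R: "\<forall>R. induced_restriction M R \<and> mdim R = k \<longrightarrow> even (msize R)"
  have M: "0 \<notin> snd M" "fst M \<subseteq> snd M" "finite (snd M)" using assms(2) unfolding matroid_iff by auto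
  have "even (card (fst M \<inter> W))"
    if W: "F2.subspace W" "W \<subseteq> insert 0 (snd M)" "F2.dim W = k" for W
  proof -
    have "induced_restriction M (restriction M (W - {0}))"
      using W M(1) flat_iff unfolding induced_restriction_def by blast
    moreover have "mdim (restriction M (W - {0})) = k"
      using W geom_dim_Diff_zero unfolding mdim_def restriction_def by simp
    ultimately have "even (msize (restriction M (W - {0})))" using R by blast
    moreover have "fst M \<inter> (W - {0}) = fst M \<inter> W" using M by blast
    ultimately show ?thesis unfolding msize_def restriction_def by simp
  qed
  then show "M \<in> even_class k"
    using even_on_if_even_dim_eq[OF assms(1)] M(3) assms(2) unfolding even_class_iff by simp
qed

text \<open>Pull a subspace \<open>W\<close> back along the isomorphism. The map is additive only on
  the space of \<open>T\<close>, so the preimage \<open>X\<close> is checked to be a subspace by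
  hand and gets its dimension from its cardinality.\<close>

lemma even_class_isomorphic:
  assumes "isomorphic M T" "T \<in> even_class k" "matroid M"
  shows "M \<in> even_class k"
proof -
  let ?V = "insert 0 (snd M)" and ?U = "insert 0 (snd T)"
  obtain f where f: "bij_betw f ?U ?V" "\<forall>x\<in>?U. \<forall>y\<in>?U. f (x + y) = f x + f y"
    "f ` fst T = fst M"
    using assms(1) unfolding isomorphic_def by (elim exE conjE) (rule that; assumption)
  have T: "F2.subspace ?U" "finite ?U" "fst T \<subseteq> ?U" "even_on k (fst T) ?U"
    using assms(2) unfolding even_class_iff matroid_iff by auto
  have inj: "inj_on f ?U" using f(1) by (rule bij_betw_imp_inj_on)
  have im: "f ` ?U = ?V" using f(1) by (rule bij_betw_imp_surj_on)
  have f0: "f 0 = 0" using f(2) by (metis f2vec_add_self insertI1)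
  have "even (card (fst M \<inter> W))"
    if W: "F2.subspace W" "W \<subseteq> ?V" "k \<le> F2.dim W" for W
  proof -
    define X where "X = {x \<in> ?U. f x \<in> W}"
    have sX: "F2.subspace X"
    proof (rule f2_subspaceI)
      show "0 \<in> X" unfolding X_def using F2.subspace_0[OF W(1)] f0 by simp
      fix x y assume "x \<in> X" "y \<in> X"
      then have xy: "x \<in> ?U" "y \<in> ?U" "f x \<in> W" "f y \<in> W" unfolding X_def by blast+
      have "f (x + y) = f x + f y" using f(2) xy(1,2) by blast
      then show "x + y \<in> X"
        unfolding X_def mem_Collect_eq
        using F2.subspace_add[OF W(1) xy(3,4)] F2.subspace_add[OF T(1) xy(1,2)] by metis
    qed
    have XU: "X \<subseteq> ?U" unfolding X_def by blast
    have fX: "f ` X = W" using im W(2) unfolding X_def by fast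
    have finX: "finite X" using XU T(2) finite_subset by blast
    have "card W = card X" using card_image[OF inj_on_subset[OF inj XU]] fX by simp
    then have "(2::nat) ^ F2.dim W = 2 ^ F2.dim X"
      using card_eq_2_pow_dim[OF sX finX] card_eq_2_pow_dim[OF W(1)] fX finX by auto
    then have "F2.dim X = F2.dim W" by (simp only: power_inject_exp)
    then have "even (card (fst T \<inter> X))" using even_onD[OF T(4) sX XU] W(3) by simp
    moreover have "f ` (fst T \<inter> X) = fst M \<inter> W"
      using inj_on_image_Int[OF inj T(3) XU] fX f(3) by simp
    moreover have "card (f ` (fst T \<inter> X)) = card (fst T \<inter> X)"
      using XU by (intro card_image inj_on_subset[OF inj]) blast
    ultimately show ?thesis by simp
  qed
  then show ?thesis using assms(3) unfolding even_class_iff even_on_def by blast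
qed

section \<open>Building up and taking apart by twist doubling\<close>

lemma even_class_twist_doubling:
  assumes "twist_doubling M N T" "M \<in> even_class (Suc k)" "N \<in> even_class k"
  shows "T \<in> even_class (Suc k)"
proof -
  obtain G' w where G': "projective_geometry G'" "hyperplane G' (snd M)" "w \<in> G' - snd M"
    "T = (fst M \<union> {w + x |x. x \<in> sym_diff (fst M) (fst N)}, G')" and MN: "snd M = snd N"
    using assms(1) unfolding twist_doubling_def by blast
  define E D H where "E = fst M" and "D = fst N" and "H = insert 0 (snd M)"
  have H: "F2.subspace H" "finite H" and E: "E \<subseteq> H - {0}" "even_on (Suc k) E H"
    and D: "D \<subseteq> H - {0}" "even_on k D H"
    using assms(2,3) MN unfolding even_class_iff matroid_iff E_def D_def H_def by auto
  have "matroid ({}, G')" using G'(1) unfolding matroid_def by simp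
  then have V: "F2.subspace (insert 0 G')" "finite G'" "0 \<notin> G'" unfolding matroid_iff by auto
  have wH: "w \<notin> H" using G'(3) V(3) unfolding H_def by auto
  have wG: "w \<in> insert 0 G'" using G'(3) by blast
  have HG: "H \<subseteq> insert 0 G'"
    using G'(2) unfolding hyperplane_def flat_def H_def by blast
  have dim: "F2.dim (insert 0 G') = F2.dim H + 1"
    using G'(2) unfolding hyperplane_def geom_dim_def H_def by simp
  \<comment> \<open>The hyperplane condition makes both sides equally large, so this inclusion
    identifies the space of \<open>G'\<close> with \<open>adjoin w H\<close>, the setting of
    \<open>even_on_twist\<close>.\<close>
  have sub: "adjoin w H \<subseteq> insert 0 G'" using HG F2.subspace_add[OF V(1) wG] by blast
  have "card (adjoin w H) = card (insert 0 G')"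
    using card_adjoin[OF H wH] card_eq_2_pow_dim[OF H] card_eq_2_pow_dim[OF V(1)] V(2) dim by simp
  then have G'_eq: "insert 0 G' = adjoin w H"
    using card_subset_eq[OF _ sub] V(2) by simp
  have T: "T = (E \<union> translate w (sym_diff E D), G')"
    using G'(4) unfolding E_def D_def setcompr_eq_translate .
  have "even_on (Suc k) (E \<union> translate w (sym_diff E D)) (insert 0 G')"
    unfolding G'_eq using even_on_twist[OF H wH _ E(2) _ D(2)] E D by blast
  moreover have "E \<union> translate w (sym_diff E D) \<subseteq> G'"
  proof -
    have "0 \<notin> E \<union> translate w (sym_diff E D)"
      using wH E(1) D(1) unfolding Un_iff mem_translate_iff by auto
    moreover have "E \<union> translate w (sym_diff E D) \<subseteq> insert 0 G'" using E D G'_eq by blast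
    ultimately show ?thesis using subset_insert by metis
  qed
  ultimately show ?thesis using V T unfolding even_class_iff matroid_iff by simp
qed

text \<open>The condition is vacuous: no flat reaches dimension \<open>k\<close>.\<close>

lemma even_class_small_dim:
  assumes "matroid M" "mdim M < k"
  shows "M \<in> even_class k"
proof -
  have "\<not> k \<le> F2.dim W" if "F2.subspace W" "W \<subseteq> insert 0 (snd M)" for W
    using dim_le_if_subspace_subset[OF that(1) _ _ that(2)] assms
    unfolding matroid_iff mdim_def geom_dim_def by auto
  then show ?thesis using assms(1) unfolding even_class_iff even_on_def by blast
qed

lemma isomorphic_refl: "isomorphic M M"
  unfolding isomorphic_def by (rule exI[of _ id]) auto

lemma even_class_decompose:
  assumes M: "M \<in> even_class (Suc k)" and dim: "k < mdim M"
  obtains M' N where "M' \<in> even_class (Suc k)" "N \<in> even_class k" "mdim M = mdim M' + 1"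
    "twist_doubling M' N M"
proof -
  define E V where "E = fst M" and "V = insert 0 (snd M)"
  have V: "F2.subspace V" "finite V" and E: "E \<subseteq> V - {0}" and ev: "even_on (Suc k) E V"
    and G: "snd M = V - {0}"
    using M unfolding even_class_iff matroid_iff E_def V_def by auto
  have dV: "F2.dim V = mdim M" unfolding V_def mdim_def geom_dim_def ..
  \<comment> \<open>Otherwise \<open>E\<close> would have \<open>2 ^ mdim M - 1\<close> elements, an
    odd number, although it is even on \<open>V\<close> itself.\<close>
  have "E \<noteq> V - {0}"
  proof
    assume eq: "E = V - {0}"
    have "card (V - {0}) = 2 ^ mdim M - 1"
      using card_eq_2_pow_dim[OF V] dV F2.subspace_0[OF V(1)] by simp
    moreover have "even (card (E \<inter> V))" using even_onD[OF ev V(1)] dV dim by simp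
    moreover have "E \<inter> V = V - {0}" using eq by blast
    ultimately have "even ((2::nat) ^ mdim M - 1)" by simp
    then show False using dim by simp
  qed
  then obtain w where w: "w \<in> V" "w \<noteq> 0" "w \<notin> E" using E by blast
  obtain H where H: "F2.subspace H" "w \<notin> H" "V = adjoin w H"
    using ex_complement_hyperplane[OF V(1) w(1,2)] .
  have finH: "finite H" using H(3) V(2) by simp
  have H0: "insert 0 (H - {0}) = H" using F2.subspace_0[OF H(1)] by blast
  \<comment> \<open>Solving the twist doubling equation: the symmetric difference of
    \<open>E \<inter> H\<close> and \<open>D\<close> has to be \<open>E\<close> outside
    \<open>H\<close>, shifted back by \<open>w\<close>. As \<open>w\<close> is not in
    \<open>E\<close>, zero is not in \<open>D\<close>.\<close>
  define D where "D = sym_diff (E \<inter> H) (translate w E \<inter> H)"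
  have D0: "0 \<notin> D" using w(3) E unfolding D_def by (auto simp: mem_translate_iff)
  let ?M' = "(E \<inter> H, H - {0})" and ?N = "(D, H - {0})"
  have "even_on (Suc k) (E \<inter> H) H"
    unfolding even_on_def
  proof safe
    fix W assume W: "F2.subspace W" "W \<subseteq> H" "Suc k \<le> F2.dim W"
    then have "E \<inter> H \<inter> W = E \<inter> W" by blast
    then show "even (card (E \<inter> H \<inter> W))" using even_onD[OF ev W(1) _ W(3)] W(2) H(3) by auto
  qed
  then have "?M' \<in> even_class (Suc k)"
    using H0 H(1) finH E unfolding even_class_iff matroid_iff by auto
  moreover have "even_on k D H"
    unfolding D_def using even_on_untwist[OF H(1) finH H(2) w(3)] ev H(3) by simp
  then have "?N \<in> even_class k"
    using H0 H(1) finH D0 unfolding even_class_iff matroid_iff D_def by auto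
  moreover have dimM: "mdim M = mdim ?M' + 1"
    using dim_adjoin[OF H(1) finH H(2)] H(3) dV geom_dim_Diff_zero[OF H(1)]
    unfolding mdim_def by simp
  moreover have "twist_doubling ?M' ?N M"
  proof -
    have "sym_diff (E \<inter> H) D = translate w E \<inter> H" unfolding D_def by blast
    moreover have "translate w (translate w E \<inter> H) = E \<inter> translate w H"
      unfolding set_eq_iff Int_iff mem_translate_iff by simp
    moreover have "(E \<inter> H) \<union> (E \<inter> translate w H) = E" using E H(3) by blast
    ultimately have "E \<inter> H \<union> {w + x |x. x \<in> sym_diff (E \<inter> H) D} = E"
      by (simp only: setcompr_eq_translate)
    then have "M = (E \<inter> H \<union> {w + x |x. x \<in> sym_diff (E \<inter> H) D}, snd M)"
      unfolding E_def by (metis prod.collapse)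
    moreover have "hyperplane (snd M) (H - {0})"
      using H dimM unfolding hyperplane_def flat_def G mdim_def by auto
    moreover have "projective_geometry (snd M)"
      using V G unfolding projective_geometry_def by blast
    moreover have "w \<in> snd M - (H - {0})" using w H(2) G by blast
    ultimately show ?thesis unfolding twist_doubling_def by auto
  qed
  ultimately show ?thesis using that by blast
qed

section \<open>Chains of twist doublings\<close>

lemma twist_doubling_snd_eq: "twist_doubling M N T \<Longrightarrow> snd M = snd N"
  unfolding twist_doubling_def by blast

text \<open>The third condition of the theorem with its parameter lowered by one, so that the
  inductions work with \<open>k\<close> and \<open>Suc k\<close> instead of a subtraction.\<close>

definition twist_doubling_chain ::
  "nat \<Rightarrow> matroid \<Rightarrow> nat \<Rightarrow> (nat \<Rightarrow> matroid) \<Rightarrow> (nat \<Rightarrow> matroid) \<Rightarrow> bool" where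
  "twist_doubling_chain k M s Ms Ns \<longleftrightarrow>
     (\<forall>i\<le>s. matroid (Ms i)) \<and> (\<forall>i<s. Ns i \<in> even_class k) \<and> mdim (Ms 0) \<le> k \<and> Ms s = M \<and>
     (\<forall>i<s. snd (Ms i) = snd (Ns i) \<and>
            (\<exists>T. twist_doubling (Ms i) (Ns i) T \<and> isomorphic (Ms (Suc i)) T))"

text \<open>Strong induction on the dimension: \<open>even_class_decompose\<close> splits off the
  last doubling until the dimension is at most \<open>k\<close>.\<close>

lemma twist_doubling_chain_exists:
  assumes "M \<in> even_class (Suc k)"
  shows "\<exists>s Ms Ns. twist_doubling_chain k M s Ms Ns"
  using assms
proof (induction "mdim M" arbitrary: M rule: less_induct)
  case less
  have matM: "matroid M" using less.prems unfolding even_class_iff by blast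
  show ?case
  proof (cases "mdim M \<le> k")
    case True
    \<comment> \<open>A chain without doublings; the second constant function is only a
      filler.\<close>
    then have "twist_doubling_chain k M 0 (\<lambda>_. M) (\<lambda>_. M)"
      using matM unfolding twist_doubling_chain_def by simp
    then show ?thesis by blast
  next
    case False
    then have "k < mdim M" by simp
    then obtain M' N where M': "M' \<in> even_class (Suc k)" "N \<in> even_class k"
      "mdim M = mdim M' + 1" "twist_doubling M' N M"
      by (rule even_class_decompose[OF less.prems])
    then obtain s Ms Ns where "twist_doubling_chain k M' s Ms Ns"
      using less.hyps[of M'] by auto
    \<comment> \<open>Append \<open>M\<close> to the chain of \<open>M'\<close>; \<open>M\<close> is
      itself the twist doubling, so the identity serves as isomorphism.\<close>
    then have "twist_doubling_chain k M (Suc s) (Ms(Suc s := M)) (Ns(s := N))"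
      using M' matM isomorphic_refl[of M] twist_doubling_snd_eq[OF M'(4)]
      unfolding twist_doubling_chain_def by (auto simp: less_Suc_eq le_Suc_eq simp del: split_paired_Ex)
    then show ?thesis by blast
  qed
qed

text \<open>Membership passes along the chain, first to the twist doubling and then through the
  isomorphism; it starts because the first matroid has dimension below \<open>Suc k\<close>.\<close>

lemma twist_doubling_chain_even_class:
  assumes "twist_doubling_chain k M s Ms Ns"
  shows "M \<in> even_class (Suc k)"
proof -
  have "i \<le> s \<Longrightarrow> Ms i \<in> even_class (Suc k)" for i
  proof (induction i)
    case 0
    then show ?case
      using assms even_class_small_dim unfolding twist_doubling_chain_def by auto
  next
    case (Suc i)
    then show ?case
      using assms even_class_twist_doubling even_class_isomorphic
      unfolding twist_doubling_chain_def by (metis Suc_leD Suc_le_lessD)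
  qed
  then show ?thesis using assms unfolding twist_doubling_chain_def by blast
qed

theorem theorem3p2:
  fixes k :: nat and M :: matroid
  assumes "k \<ge> 2" and "matroid M"
  shows "(M \<in> even_class k \<longleftrightarrow>
           (\<forall>R. induced_restriction M R \<and> mdim R = k \<longrightarrow> even (msize R))) \<and>
         (M \<in> even_class k \<longleftrightarrow>
           (\<exists>(s :: nat) (Ms :: nat \<Rightarrow> matroid) (Ns :: nat \<Rightarrow> matroid).
              (\<forall>i\<le>s. matroid (Ms i)) \<and>
              (\<forall>i<s. Ns i \<in> even_class (k - 1)) \<and>
              mdim (Ms 0) \<le> k - 1 \<and> Ms s = M \<and>
              (\<forall>i<s. snd (Ms i) = snd (Ns i) \<and>
                     (\<exists>T. twist_doubling (Ms i) (Ns i) T \<and> isomorphic (Ms (Suc i)) T))))"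
proof
  show "M \<in> even_class k \<longleftrightarrow>
      (\<forall>R. induced_restriction M R \<and> mdim R = k \<longrightarrow> even (msize R))"
    using even_class_iff_induced_restriction assms by simp
  have k: "k = Suc (k - 1)" using assms(1) by simp
  have "M \<in> even_class k \<longleftrightarrow> (\<exists>s Ms Ns. twist_doubling_chain (k - 1) M s Ms Ns)"
    using twist_doubling_chain_exists[of M "k - 1"] twist_doubling_chain_even_class[of "k - 1" M] k
    by metis
  then show "M \<in> even_class k \<longleftrightarrow>
           (\<exists>(s :: nat) (Ms :: nat \<Rightarrow> matroid) (Ns :: nat \<Rightarrow> matroid).
              (\<forall>i\<le>s. matroid (Ms i)) \<and>
              (\<forall>i<s. Ns i \<in> even_class (k - 1)) \<and>
              mdim (Ms 0) \<le> k - 1 \<and> Ms s = M \<and>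
              (\<forall>i<s. snd (Ms i) = snd (Ns i) \<and>
                     (\<exists>T. twist_doubling (Ms i) (Ns i) T \<and> isomorphic (Ms (Suc i)) T)))"
    unfolding twist_doubling_chain_def .
qed

end
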